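(* Let $n\in\mathbb{N}$ ($n\ge 1$) and let $A$ be the rank one operator on $A^2(\mathbb{D})$ given by $A(f)=\langle f,z^n\rangle z^n$ for $f\in A^2(\mathbb{D})$. Then the Berezin range of $A$ is $$\mathrm{Ber}(A)=\left[0,\frac{4n^n}{(n+2)^{n+2}}\right],$$ which is convex in $\mathbb{C}$.
   Context: $\mathbb{D}$ is the open unit disc in $\mathbb{C}$. $A^2(\mathbb{D})$ is the Bergman space of holomorphic functions $f$ on $\mathbb{D}$ with $\int_{\mathbb{D}}|f(z)|^2\,dV(z)<\infty$, where $dV$ is the normalized area measure on $\mathbb{D}$, with inner product $\langle f,g\rangle=\int_{\mathbb{D}}f(z)\overline{g(z)}\,dV(z)$. It is a reproducing kernel Hilbert space with reproducing kernel $k_\lambda(z)=\frac{1}{(1-\bar\lambda z)^2}$ at $\lambda\in\mathbb{D}$, and $\hat{k}_\lambda=k_\lambda/\|k_\lambda\|$ is the normalized reproducing kernel. $z^n$ denotes the function $z\mapsto z^n$. For a bounded linear operator $T$ on $A^2(\mathbb{D})$, the Berezin transform is $\widetilde{T}(\lambda)=\langle T\hat{k}_\lambda,\hat{k}_\lambda\rangle$ for $\lambda\in\mathbb{D}$, and the Berezin range is $\mathrm{Ber}(T)=\{\widetilde{T}(\lambda):\lambda\in\mathbb{D}\}$. *)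

theory Defs
  imports "HOL-Complex_Analysis.Complex_Analysis"
begin

abbreviation unit_disc :: "complex set" where
  "unit_disc \<equiv> ball 0 1"

definition disc_measure :: "complex measure" where
  "disc_measure = uniform_measure (lebesgue_on unit_disc) unit_disc"

(* A function on the disc is represented by a total function that is undefined
   off the disc, so that equality in HOL is equality of functions on the disc. *)
definition bergman_space :: "(complex \<Rightarrow> complex) set" where
  "bergman_space =
     {f \<in> extensional unit_disc.
        f holomorphic_on unit_disc \<and> integrable disc_measure (\<lambda>z. (cmod (f z))\<^sup>2)}"

definition bergman_inner :: "(complex \<Rightarrow> complex) \<Rightarrow> (complex \<Rightarrow> complex) \<Rightarrow> complex" where
  "bergman_inner f g = (LINT z|disc_measure. f z * cnj (g z))"

definition bergman_norm :: "(complex \<Rightarrow> complex) \<Rightarrow> real" where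
  "bergman_norm f = sqrt (Re (bergman_inner f f))"

definition bergman_kernel :: "complex \<Rightarrow> complex \<Rightarrow> complex" where
  "bergman_kernel l = (\<lambda>z\<in>unit_disc. 1 / (1 - cnj l * z)\<^sup>2)"

definition normalized_kernel :: "complex \<Rightarrow> complex \<Rightarrow> complex" where
  "normalized_kernel l =
     (\<lambda>z\<in>unit_disc. bergman_kernel l z / of_real (bergman_norm (bergman_kernel l)))"

definition disc_monomial :: "nat \<Rightarrow> complex \<Rightarrow> complex" where
  "disc_monomial n = (\<lambda>z\<in>unit_disc. z ^ n)"

(* Used for maps T from bergman_space to itself; values of T elsewhere are irrelevant. *)
definition berezin_transform ::
    "((complex \<Rightarrow> complex) \<Rightarrow> complex \<Rightarrow> complex) \<Rightarrow> complex \<Rightarrow> complex" where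
  "berezin_transform T l = bergman_inner (T (normalized_kernel l)) (normalized_kernel l)"

definition berezin_range ::
    "((complex \<Rightarrow> complex) \<Rightarrow> complex \<Rightarrow> complex) \<Rightarrow> complex set" where
  "berezin_range T = berezin_transform T ` unit_disc"

end

theory Submission
  imports Defs "HOL-Probability.Distributions"
begin

text \<open>
  For the rank one operator \<open>f \<mapsto> \<langle>f, z\<^sup>n\<rangle> z\<^sup>n\<close> the Berezin transform at \<open>l\<close> is the square of
  the modulus of \<open>\<langle>z\<^sup>n, k\<rangle>\<close>, with \<open>k\<close> the normalized kernel at \<open>l\<close>. By the
  reproducing property \<open>\<langle>z\<^sup>n, k\<rangle>\<close> is \<open>l\<^sup>n\<close> divided by the norm of the kernel, and the norm is
  \<open>1 / (1 - |l|\<^sup>2)\<close>. So the transform equals \<open>t\<^sup>n (1 - t)\<^sup>2\<close> for \<open>t = |l|\<^sup>2\<close>, where \<open>t\<close>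
  runs through all of \<open>[0, 1)\<close>. This function vanishes at \<open>0\<close> and attains its maximum
  \<open>4 n\<^sup>n / (n + 2)\<^bsup>n + 2\<^esup>\<close> at \<open>t = n / (n + 2)\<close>, so by the intermediate value theorem its
  image is the asserted interval.

  The work lies in the two facts about the kernel. Expanding it into its power series
  (\<open>bergman_inner_kernel_sums\<close>) reduces both to the orthogonality and the norms of the monomials
  (\<open>monomial_moments\<close>). Orthogonality comes from the invariance of area under rotations, a case of
  \<open>lborel_distr_orthogonal_transformation\<close>, and the norms from the uniform distribution of
  \<open>|z|\<^sup>2\<close> under normalized area measure (\<open>norm_power2_uniform\<close>).
\<close>

section \<open>Invariance of Lebesgue measure under orthogonal maps\<close>

lemma nn_integral_lborel_translate:
  fixes h :: "'a::euclidean_space \<Rightarrow> ennreal"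
  assumes [measurable]: "h \<in> borel_measurable borel"
  shows "(\<integral>\<^sup>+x. h (a + x) \<partial>lborel) = (\<integral>\<^sup>+x. h x \<partial>lborel)"
proof -
  have "(\<integral>\<^sup>+x. h x \<partial>lborel) = (\<integral>\<^sup>+x. h x \<partial>distr lborel borel ((+) a))"
    by (simp add: lborel_distr_plus)
  then show ?thesis
    by (simp add: nn_integral_distr)
qed

text \<open>
  The usual argument for uniqueness of a translation-invariant measure: with \<open>B\<close> the unit ball and
  \<open>\<mu>\<close> the push-forward of \<open>\<lambda>\<close>, the double integral for \<open>\<mu>(A) \<lambda>(B)\<close> is translated in one
  variable, swapped by Fubini, and translated in the other, which turns it into
  \<open>\<lambda>(A) \<mu>(B)\<close>. An isometry preserves \<open>B\<close>, so that \<open>\<mu>(B) = \<lambda>(B)\<close> can be cancelled.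
\<close>
lemma lborel_distr_orthogonal_transformation:
  fixes f :: "'a::euclidean_space \<Rightarrow> 'a"
  assumes f: "orthogonal_transformation f"
  shows "distr lborel borel f = lborel"
proof (rule measure_eqI)
  have lin: "linear f" and iso: "norm (f x) = norm x" for x
    using f by (auto simp: orthogonal_transformation)
  have [measurable]: "f \<in> borel_measurable borel"
    using lin by (intro borel_measurable_continuous_onI linear_continuous_on) (simp add: linear_conv_bounded_linear)
  fix A :: "'a set" assume "A \<in> sets (distr lborel borel f)"
  then have [measurable]: "A \<in> sets borel" by simp
  define B :: "'a set" where "B = ball 0 1"
  define v where "v = emeasure lborel B"
  have [measurable]: "B \<in> sets borel" by (simp add: B_def)
  have v: "v \<noteq> 0" "v \<noteq> \<infinity>"
    using order.strict_implies_not_eq[OF unit_ball_vol_pos[of "real DIM('a)", OF of_nat_0_le_iff]]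
    by (auto simp: v_def B_def emeasure_ball)
  have "emeasure (distr lborel borel f) A * v
      = (\<integral>\<^sup>+y. \<integral>\<^sup>+u. indicator A (f u) * indicator B y \<partial>lborel \<partial>lborel)"
  proof -
    have "emeasure (distr lborel borel f) A = (\<integral>\<^sup>+u. indicator A (f u) \<partial>lborel)"
      using nn_integral_distr[of f lborel borel "indicator A"] by simp
    then show ?thesis
      by (simp add: nn_integral_multc nn_integral_cmult v_def)
  qed
  also have "\<dots> = (\<integral>\<^sup>+y. \<integral>\<^sup>+u. indicator A (f u + y) * indicator B y \<partial>lborel \<partial>lborel)"
  proof (rule nn_integral_cong)
    fix y :: 'a
    obtain w where "y = f w"
      using orthogonal_transformation_surj[OF f] by (metis surjD)
    then have "f u + y = f (w + u)" for u
      by (simp add: linear_add[OF lin] add.commute)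
    then show "(\<integral>\<^sup>+u. indicator A (f u) * indicator B y \<partial>lborel) =
        (\<integral>\<^sup>+u. indicator A (f u + y) * (indicator B y :: ennreal) \<partial>lborel)"
      using nn_integral_lborel_translate[of "\<lambda>u. indicator A (f u) * indicator B y" w] by simp
  qed
  also have "\<dots> = (\<integral>\<^sup>+u. \<integral>\<^sup>+y. indicator A (f u + y) * indicator B y \<partial>lborel \<partial>lborel)"
    by (rule lborel_pair.Fubini') measurable
  also have "\<dots> = (\<integral>\<^sup>+u. \<integral>\<^sup>+y. indicator A y * indicator B (y - f u) \<partial>lborel \<partial>lborel)"
  proof (rule nn_integral_cong)
    fix u :: 'a
    show "(\<integral>\<^sup>+y. indicator A (f u + y) * indicator B y \<partial>lborel) =
        (\<integral>\<^sup>+y. indicator A y * (indicator B (y - f u) :: ennreal) \<partial>lborel)"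
      using nn_integral_lborel_translate[of "\<lambda>y. indicator A y * indicator B (y - f u)" "f u"]
      by simp
  qed
  also have "\<dots> = (\<integral>\<^sup>+y. \<integral>\<^sup>+u. indicator A y * indicator B (y - f u) \<partial>lborel \<partial>lborel)"
    by (rule lborel_pair.Fubini') measurable
  \<comment> \<open>The isometry carries the ball around \<open>w\<close> to the ball around \<open>f w\<close>, so the inner integral is \<open>v\<close>.\<close>
  also have "\<dots> = (\<integral>\<^sup>+y. indicator A y * v \<partial>lborel)"
  proof (rule nn_integral_cong)
    fix y :: 'a
    obtain w where "y = f w"
      using orthogonal_transformation_surj[OF f] by (metis surjD)
    then have "y - f u = f (w - u)" for u
      by (simp add: linear_diff[OF lin])
    then have "(indicator B (y - f u) :: ennreal) = indicator B (- w + u)" for u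
      using norm_minus_commute[of w u] by (simp add: B_def indicator_def iso)
    then show "(\<integral>\<^sup>+u. indicator A y * indicator B (y - f u) \<partial>lborel) = indicator A y * v"
      using nn_integral_lborel_translate[of "indicator B" "-w"] by (simp add: nn_integral_cmult v_def)
  qed
  also have "\<dots> = emeasure lborel A * v"
    by (simp add: nn_integral_multc)
  finally show "emeasure (distr lborel borel f) A = emeasure lborel A"
    using v ennreal_mult_cancel_left[of v] by (simp add: mult.commute)
qed simp

section \<open>Moments of normalized area measure\<close>

lemma space_disc_measure [simp]: "space disc_measure = unit_disc"
  by (simp add: disc_measure_def)

lemma measurable_disc_measure: "measurable disc_measure N = measurable (lebesgue_on unit_disc) N"
  unfolding disc_measure_def by (rule measurable_cong_sets) simp_all

lemma borel_measurable_disc_measure: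
  "f \<in> borel_measurable borel \<Longrightarrow> f \<in> borel_measurable disc_measure"
  by (simp add: measurable_disc_measure measurable_restrict_space1 measurable_completion)

text \<open>
  On Borel sets, Lebesgue measure on the disc can be replaced by \<^term>\<open>lborel\<close>, to which the
  invariance under rotations applies.
\<close>
lemma emeasure_disc_measure:
  assumes A: "A \<in> sets borel"
  shows "emeasure disc_measure (A \<inter> unit_disc) = emeasure lborel (A \<inter> unit_disc) / ennreal pi"
proof -
  have leb: "emeasure (lebesgue_on unit_disc) (S \<inter> unit_disc) = emeasure lborel (S \<inter> unit_disc)"
    if "S \<in> sets borel" for S :: "complex set"
  proof -
    have "S \<inter> unit_disc \<in> sets lborel"
      using that by simp
    then show ?thesis
      by (simp add: emeasure_restrict_space)
  qed
  have "unit_disc \<in> sets (lebesgue_on unit_disc)" "A \<inter> unit_disc \<in> sets (lebesgue_on unit_disc)"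
    using A by (simp_all add: sets_restrict_space_iff)
  then have "emeasure disc_measure (A \<inter> unit_disc) =
      emeasure (lebesgue_on unit_disc) (unit_disc \<inter> (A \<inter> unit_disc)) /
      emeasure (lebesgue_on unit_disc) (UNIV \<inter> unit_disc)"
    by (simp add: disc_measure_def)
  also have "unit_disc \<inter> (A \<inter> unit_disc) = A \<inter> unit_disc"
    by blast
  also have "emeasure (lebesgue_on unit_disc) (UNIV \<inter> unit_disc) = ennreal pi"
    by (subst leb) (simp_all add: emeasure_ball unit_ball_vol_2)
  also have "emeasure (lebesgue_on unit_disc) (A \<inter> unit_disc) = emeasure lborel (A \<inter> unit_disc)"
    by (rule leb[OF A])
  finally show ?thesis .
qed

lemma prob_space_disc_measure: "prob_space disc_measure"
proof (rule prob_spaceI)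
  have "emeasure disc_measure (UNIV \<inter> unit_disc) = emeasure lborel (UNIV \<inter> unit_disc) / ennreal pi"
    by (rule emeasure_disc_measure) simp
  also have "\<dots> = ennreal pi / ennreal pi"
    by (simp add: emeasure_ball unit_ball_vol_2)
  also have "\<dots> = 1"
    by (simp add: divide_ennreal)
  finally show "emeasure disc_measure (space disc_measure) = 1"
    by simp
qed

lemma disc_measure_rotate:
  fixes g :: "complex \<Rightarrow> complex"
  assumes c: "cmod c = 1" and g [measurable]: "g \<in> borel_measurable borel"
  shows "(LINT z|disc_measure. g (c * z)) = (LINT z|disc_measure. g z)"
proof -
  have "orthogonal_transformation ((*) c)"
    using c by (simp add: orthogonal_transformation norm_mult linear_times)
  note rot = lborel_distr_orthogonal_transformation[OF this]
  have mult: "(*) c \<in> borel_measurable borel"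
    by (rule borel_measurable_continuous_onI[OF linear_continuous_on[OF bounded_linear_mult_right]])
  note mult_disc = borel_measurable_disc_measure[OF mult]
  have "distr disc_measure borel ((*) c) = distr disc_measure borel (\<lambda>z. z)"
  proof (rule measure_eqI)
    fix A assume "A \<in> sets (distr disc_measure borel ((*) c))"
    then have [measurable]: "A \<in> sets borel" by simp
    have AD: "A \<inter> unit_disc \<in> sets borel"
      by measurable
    have "emeasure lborel (A \<inter> unit_disc) = emeasure lborel ((*) c -` (A \<inter> unit_disc))"
      using emeasure_distr[OF _ AD, of "(*) c" lborel] mult
      by (simp add: rot space_borel)
    also have "(*) c -` (A \<inter> unit_disc) = ((*) c -` A) \<inter> unit_disc"
      using c by (auto simp: norm_mult)
    finally have "emeasure disc_measure ((*) c -` A \<inter> unit_disc) = emeasure disc_measure (A \<inter> unit_disc)"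
      using measurable_sets[OF mult, of A] by (simp add: emeasure_disc_measure)
    then show "emeasure (distr disc_measure borel ((*) c)) A = emeasure (distr disc_measure borel (\<lambda>z. z)) A"
      by (simp add: emeasure_distr mult_disc borel_measurable_disc_measure)
  qed simp
  from arg_cong[OF this, of "\<lambda>M. integral\<^sup>L M g"] show ?thesis
    by (simp add: integral_distr mult_disc borel_measurable_disc_measure)
qed

text \<open>
  The disc of radius \<open>\<surd>t\<close> has area \<open>\<pi>t\<close>, so \<open>|z|\<^sup>2\<close> has a linear distribution
  function. This replaces polar coordinates in the computation of the norm of a monomial.
\<close>
lemma norm_power2_uniform:
  "distributed disc_measure lborel (\<lambda>z. (cmod z)\<^sup>2) (\<lambda>x. indicator {0..1} x / measure lborel {0..1::real})"
proof -
  interpret prob_space disc_measure by (rule prob_space_disc_measure)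
  show ?thesis
  proof (rule uniform_distrI_borel_atLeastAtMost)
    show "(\<lambda>z. (cmod z)\<^sup>2) \<in> borel_measurable disc_measure"
      by (rule borel_measurable_disc_measure) measurable
  next
    fix t :: real assume t: "0 \<le> t" "t \<le> 1"
    have *: "(cmod z)\<^sup>2 \<le> t \<longleftrightarrow> cmod z \<le> sqrt t" for z
      using real_le_rsqrt real_sqrt_le_iff sqrt_le_D by (metis norm_ge_zero real_sqrt_abs abs_norm_cancel)
    have "emeasure disc_measure {z \<in> space disc_measure. (cmod z)\<^sup>2 \<le> t}
        = emeasure disc_measure (cball 0 (sqrt t) \<inter> unit_disc)"
      by (rule arg_cong[where f = "emeasure _"]) (auto simp: *)
    also have "\<dots> = emeasure lborel (cball (0::complex) (sqrt t) \<inter> unit_disc) / pi"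
      by (rule emeasure_disc_measure) simp
    also have "emeasure lborel (cball (0::complex) (sqrt t) \<inter> unit_disc) = ennreal (pi * t)"
    proof (rule antisym)
      have "emeasure lborel (cball (0::complex) (sqrt t) \<inter> unit_disc) \<le> emeasure lborel (cball (0::complex) (sqrt t))"
        by (rule emeasure_mono) simp_all
      also have "\<dots> = ennreal (pi * t)"
        using t by (subst emeasure_cball) (simp_all add: unit_ball_vol_2)
      finally show "emeasure lborel (cball (0::complex) (sqrt t) \<inter> unit_disc) \<le> ennreal (pi * t)" .
      have "ennreal (pi * t) = emeasure lborel (ball (0::complex) (sqrt t))"
        using t by (subst emeasure_ball) (simp_all add: unit_ball_vol_2)
      also have "\<dots> \<le> emeasure lborel (cball (0::complex) (sqrt t) \<inter> unit_disc)"
      proof (rule emeasure_mono)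
        have "sqrt t \<le> 1"
          using t by simp
        then show "ball (0::complex) (sqrt t) \<subseteq> cball 0 (sqrt t) \<inter> unit_disc"
          by (rule Int_greatest[OF ball_subset_cball subset_ball])
      qed simp
      finally show "ennreal (pi * t) \<le> emeasure lborel (cball (0::complex) (sqrt t) \<inter> unit_disc)" .
    qed
    finally show "\<P>(z in disc_measure. (cmod z)\<^sup>2 \<le> t) = (t - 0) / (1 - 0)"
      using t by (simp add: divide_ennreal measure_def)
  qed simp_all
qed

text \<open>
  A rotation by \<open>c\<close> multiplies the integral by \<open>c\<^sup>m\<close> times the conjugate of \<open>c\<^sup>k\<close>, which
  forces it to vanish for \<open>m \<noteq> k\<close>. For \<open>m = k\<close> it is the \<open>m\<close>-th moment of the
  uniform distribution on the unit interval.
\<close>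
lemma monomial_moments:
  "(LINT z|disc_measure. z ^ m * cnj (z ^ k)) = (if m = k then 1 / of_nat (Suc m) else 0)"
proof (cases "m = k")
  case False
  let ?I = "LINT z|disc_measure. z ^ m * cnj (z ^ k)"
  \<comment> \<open>The angle is chosen to make the factor equal to \<open>-1\<close>.\<close>
  define c where "c = cis (pi / (real m - real k))"
  have c: "c ^ m * cnj (c ^ k) = -1"
  proof -
    have "c ^ m * cnj (c ^ k) = cis (real m * (pi / (real m - real k)) - real k * (pi / (real m - real k)))"
      by (simp add: c_def Complex.DeMoivre cis_cnj cis_mult flip: complex_cnj_power)
    also have "real m * (pi / (real m - real k)) - real k * (pi / (real m - real k)) = pi"
      using False by (simp only: left_diff_distrib [symmetric]) simp
    finally show ?thesis by simp
  qed
  have "?I = (LINT z|disc_measure. (c * z) ^ m * cnj ((c * z) ^ k))"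
  proof (rule disc_measure_rotate[symmetric])
    show "(\<lambda>z. z ^ m * cnj (z ^ k)) \<in> borel_measurable borel"
      by (intro borel_measurable_continuous_onI continuous_intros)
  qed (simp add: c_def)
  also have "\<dots> = (LINT z|disc_measure. (c ^ m * cnj (c ^ k)) * (z ^ m * cnj (z ^ k)))"
    by (rule Bochner_Integration.integral_cong) (simp_all add: power_mult_distrib)
  also have "\<dots> = - ?I"
    by (simp only: c integral_mult_right_zero) simp
  finally show ?thesis using False by simp
next
  case True
  interpret prob_space disc_measure by (rule prob_space_disc_measure)
  have "z ^ m * cnj (z ^ m) = of_real (((cmod z)\<^sup>2) ^ m)" for z
    by (simp only: complex_cnj_power power_mult_distrib [symmetric] complex_norm_square [symmetric]
        of_real_power)
  then have "(LINT z|disc_measure. z ^ m * cnj (z ^ k)) = of_real (LINT z|disc_measure. ((cmod z)\<^sup>2) ^ m)"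
    using True by (simp only: integral_complex_of_real)
  also have "(LINT z|disc_measure. ((cmod z)\<^sup>2) ^ m) = (LINT x|lborel. indicator {0..1} x / measure lborel {0..1::real} * x ^ m)"
    by (rule distributed_integral[symmetric, OF norm_power2_uniform]) simp_all
  also have "\<dots> = (LINT x|lborel. x ^ m * indicator {0..1} x)"
    by (simp add: mult.commute)
  also have "\<dots> = 1 / of_nat (Suc m)"
    by (subst integral_power) simp_all
  finally show ?thesis using True by simp
qed

section \<open>The Bergman kernel\<close>

lemma bergman_inner_cnj: "bergman_inner g f = cnj (bergman_inner f g)"
  using Bochner_Integration.integral_cnj[of disc_measure "\<lambda>z. f z * cnj (g z)"]
  by (simp add: bergman_inner_def mult.commute)

lemma bergman_inner_cong:
  "(\<And>z. z \<in> unit_disc \<Longrightarrow> f z = f' z) \<Longrightarrow> (\<And>z. z \<in> unit_disc \<Longrightarrow> g z = g' z) \<Longrightarrow>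
    bergman_inner f g = bergman_inner f' g'"
  unfolding bergman_inner_def by (rule Bochner_Integration.integral_cong) auto

lemma bergman_inner_scale_left:
  "bergman_inner (\<lambda>z. c * f z) g = c * bergman_inner f g"
  by (simp add: bergman_inner_def mult.assoc)

lemma bergman_inner_scale_right:
  "bergman_inner f (\<lambda>z. c * g z) = cnj c * bergman_inner f g"
  by (subst (1 2) bergman_inner_cnj) (simp add: bergman_inner_scale_left)

lemma one_minus_mult_nonzero:
  fixes a z :: complex
  assumes "cmod a < 1" "cmod z < 1"
  shows "1 - cnj a * z \<noteq> 0"
proof
  assume "1 - cnj a * z = 0"
  then have "cmod a * cmod z = 1"
    by (metis complex_mod_cnj eq_iff_diff_eq_0 norm_mult norm_one)
  moreover have "cmod a * cmod z < 1 * 1"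
    using assms by (intro mult_strict_mono') auto
  ultimately show False by simp
qed

lemma borel_measurable_bergman_kernel: "bergman_kernel l \<in> borel_measurable disc_measure"
proof -
  have "(\<lambda>z. 1 / (1 - cnj l * z)\<^sup>2) \<in> borel_measurable disc_measure"
    by (rule borel_measurable_disc_measure) measurable
  moreover have "bergman_kernel l \<in> borel_measurable disc_measure \<longleftrightarrow>
      (\<lambda>z. 1 / (1 - cnj l * z)\<^sup>2) \<in> borel_measurable disc_measure"
    by (rule measurable_cong) (simp add: bergman_kernel_def)
  ultimately show ?thesis by blast
qed

lemma norm_bergman_kernel_le:
  assumes l: "cmod l < 1" and z: "z \<in> unit_disc"
  shows "cmod (bergman_kernel l z) \<le> 1 / (1 - cmod l)\<^sup>2"
proof -
  have "cmod (cnj l * z) \<le> cmod l * 1"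
    unfolding norm_mult using z by (intro mult_mono) auto
  then have "1 - cmod l \<le> cmod (1 - cnj l * z)"
    using norm_triangle_ineq2[of 1 "cnj l * z"] by simp
  then have "(1 - cmod l)\<^sup>2 \<le> (cmod (1 - cnj l * z))\<^sup>2"
    using l by (intro power_mono) auto
  moreover have "0 < (1 - cmod l)\<^sup>2"
    using l by simp
  ultimately have "1 / (cmod (1 - cnj l * z))\<^sup>2 \<le> 1 / (1 - cmod l)\<^sup>2"
    by (intro frac_le) auto
  then show ?thesis
    using z by (simp add: bergman_kernel_def norm_divide norm_power)
qed

text \<open>
  The power series of the kernel in \<open>z\<close> has terms dominated by \<open>(m + 1) |l|\<^sup>m\<close> on the whole
  disc, so for bounded \<open>f\<close> the inner product can be taken term by term. This weak form of the
  reproducing property reduces both inner products needed below to coefficients against monomials.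
\<close>
lemma bergman_inner_kernel_sums:
  assumes l: "cmod l < 1"
    and f [measurable]: "f \<in> borel_measurable disc_measure"
    and B: "\<And>z. z \<in> unit_disc \<Longrightarrow> cmod (f z) \<le> B"
  shows "(\<lambda>m. of_nat (Suc m) * l ^ m * bergman_inner f (disc_monomial m)) sums
    bergman_inner f (bergman_kernel l)"
proof -
  interpret prob_space disc_measure by (rule prob_space_disc_measure)
  define F where "F = (\<lambda>m z. f z * (of_nat (Suc m) * (l * cnj z) ^ m))"
  have lz: "cmod (l * cnj z) \<le> cmod l" if "z \<in> unit_disc" for z
    using that mult_left_mono[of "cmod z" 1 "cmod l"] by (simp add: norm_mult)
  have F_le: "cmod (F m z) \<le> B * (real (Suc m) * cmod l ^ m)" if "z \<in> unit_disc" for m z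
  proof -
    have "cmod (F m z) = cmod (f z) * (real (Suc m) * cmod (l * cnj z) ^ m)"
      unfolding F_def norm_mult norm_power norm_of_nat by simp
    also have "\<dots> \<le> B * (real (Suc m) * cmod l ^ m)"
      using that B[OF that] order.trans[OF norm_ge_zero B[OF that]] lz[OF that]
      by (intro mult_mono power_mono) auto
    finally show ?thesis .
  qed
  have bound_summable: "summable (\<lambda>m. B * (real (Suc m) * cmod l ^ m))"
    using geometric_deriv_sums[of "cmod l"] l by (intro summable_mult sums_summable) auto
  have F_meas: "F m \<in> borel_measurable disc_measure" for m
    unfolding F_def
    by (intro borel_measurable_times f borel_measurable_disc_measure
        borel_measurable_continuous_onI continuous_intros)
  have F_int: "integrable disc_measure (F m)" for m
    using F_le F_meas by (intro integrable_const_bound[of _ "B * (real (Suc m) * cmod l ^ m)"]) auto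
  have "(\<lambda>m. LINT z|disc_measure. F m z) sums (LINT z|disc_measure. (\<Sum>m. F m z))"
  proof (rule sums_integral)
    show "AE z in disc_measure. summable (\<lambda>m. cmod (F m z))"
      using F_le by (intro AE_I2 summable_comparison_test'[OF bound_summable, of 0]) simp
    show "summable (\<lambda>m. LINT z|disc_measure. cmod (F m z))"
    proof (rule summable_comparison_test'[OF bound_summable, of 0])
      fix m
      have "(LINT z|disc_measure. cmod (F m z)) \<le> B * (real (Suc m) * cmod l ^ m)"
        using F_le F_int by (intro integral_le_const AE_I2) auto
      moreover have "0 \<le> (LINT z|disc_measure. cmod (F m z))"
        by simp
      ultimately show "norm (LINT z|disc_measure. cmod (F m z)) \<le> B * (real (Suc m) * cmod l ^ m)"
        by simp
    qed
  qed (rule F_int)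
  also have "(LINT z|disc_measure. (\<Sum>m. F m z)) = bergman_inner f (bergman_kernel l)"
    unfolding bergman_inner_def
  proof (rule Bochner_Integration.integral_cong)
    fix z assume "z \<in> space disc_measure"
    then have z: "z \<in> unit_disc" by simp
    then have "(\<lambda>m. F m z) sums (f z * (1 / (1 - l * cnj z)\<^sup>2))"
      unfolding F_def using lz[OF z] l by (intro sums_mult geometric_deriv_sums) auto
    then show "(\<Sum>m. F m z) = f z * cnj (bergman_kernel l z)"
      using z by (simp add: sums_unique [symmetric] bergman_kernel_def)
  qed simp
  also have "(\<lambda>m. LINT z|disc_measure. F m z) =
      (\<lambda>m. of_nat (Suc m) * l ^ m * bergman_inner f (disc_monomial m))"
  proof
    fix m
    have "bergman_inner f (disc_monomial m) = (LINT z|disc_measure. f z * cnj (z ^ m))"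
      unfolding bergman_inner_def
      by (rule Bochner_Integration.integral_cong) (auto simp: disc_monomial_def)
    moreover have "(LINT z|disc_measure. F m z) =
        (LINT z|disc_measure. (of_nat (Suc m) * l ^ m) * (f z * cnj (z ^ m)))"
      by (simp add: F_def power_mult_distrib mult_ac)
    ultimately show "(LINT z|disc_measure. F m z) =
        of_nat (Suc m) * l ^ m * bergman_inner f (disc_monomial m)"
      by (simp only: integral_mult_right_zero)
  qed
  finally show ?thesis .
qed

lemma bergman_inner_monomial_kernel:
  assumes l: "cmod l < 1"
  shows "bergman_inner (disc_monomial n) (bergman_kernel l) = l ^ n"
proof -
  have meas: "disc_monomial n \<in> borel_measurable disc_measure"
  proof -
    have "(\<lambda>z. z ^ n) \<in> borel_measurable disc_measure"
      by (rule borel_measurable_disc_measure) measurable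
    moreover have "disc_monomial n \<in> borel_measurable disc_measure \<longleftrightarrow>
        (\<lambda>z. z ^ n) \<in> borel_measurable disc_measure"
      by (rule measurable_cong) (simp add: disc_monomial_def)
    ultimately show ?thesis by blast
  qed
  have bound: "cmod (disc_monomial n z) \<le> 1" if "z \<in> unit_disc" for z
    using that by (simp add: disc_monomial_def norm_power power_le_one)
  have "bergman_inner (disc_monomial n) (disc_monomial m) =
      (LINT z|disc_measure. z ^ n * cnj (z ^ m))" for m
    unfolding bergman_inner_def
    by (rule Bochner_Integration.integral_cong) (auto simp: disc_monomial_def)
  then have "(\<lambda>m. of_nat (Suc m) * l ^ m * bergman_inner (disc_monomial n) (disc_monomial m)) =
      (\<lambda>m. if m = n then l ^ m else 0)"
    by (auto simp: monomial_moments simp del: of_nat_Suc complex_cnj_power)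
  moreover have "\<dots> sums (l ^ n)"
    by (rule sums_single)
  ultimately show ?thesis
    using sums_unique2 bergman_inner_kernel_sums[OF l meas bound] by metis
qed

lemma bergman_inner_kernel_kernel:
  assumes l: "cmod l < 1"
  shows "bergman_inner (bergman_kernel l) (bergman_kernel l) = of_real (1 / (1 - (cmod l)\<^sup>2)\<^sup>2)"
proof -
  have "of_nat (Suc m) * l ^ m * bergman_inner (bergman_kernel l) (disc_monomial m) =
      of_nat (Suc m) * (l * cnj l) ^ m" for m
    by (subst bergman_inner_cnj)
       (simp add: bergman_inner_monomial_kernel[OF l] power_mult_distrib)
  then have "(\<lambda>m. of_nat (Suc m) * (l * cnj l) ^ m) sums
      bergman_inner (bergman_kernel l) (bergman_kernel l)"
    using bergman_inner_kernel_sums[OF l borel_measurable_bergman_kernel norm_bergman_kernel_le[OF l]]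
    by (simp only:)
  moreover have "cmod (l * cnj l) < 1"
    using l by (simp add: norm_mult abs_square_less_1 flip: power2_eq_square)
  then have "(\<lambda>m. of_nat (Suc m) * (l * cnj l) ^ m) sums (1 / (1 - l * cnj l)\<^sup>2)"
    by (rule geometric_deriv_sums)
  ultimately have "bergman_inner (bergman_kernel l) (bergman_kernel l) = 1 / (1 - l * cnj l)\<^sup>2"
    by (rule sums_unique2)
  then show ?thesis
    by (simp flip: complex_norm_square)
qed

lemma normalized_kernel_eq:
  assumes l: "cmod l < 1" and z: "z \<in> unit_disc"
  shows "normalized_kernel l z = of_real (1 - (cmod l)\<^sup>2) * bergman_kernel l z"
proof -
  have "0 < 1 - (cmod l)\<^sup>2"
    using l by (simp add: abs_square_less_1)
  then have "bergman_norm (bergman_kernel l) = 1 / (1 - (cmod l)\<^sup>2)"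
    unfolding bergman_norm_def bergman_inner_kernel_kernel[OF l] by (simp add: real_sqrt_divide)
  then show ?thesis
    using z by (simp add: normalized_kernel_def)
qed

lemma normalized_kernel_in_bergman_space:
  assumes l: "cmod l < 1"
  shows "normalized_kernel l \<in> bergman_space"
  unfolding bergman_space_def
proof (intro CollectI conjI)
  interpret prob_space disc_measure by (rule prob_space_disc_measure)
  let ?c = "complex_of_real (1 - (cmod l)\<^sup>2)"
  show "normalized_kernel l \<in> extensional unit_disc"
    by (simp add: normalized_kernel_def)
  have "(\<lambda>z. ?c * (1 / (1 - cnj l * z)\<^sup>2)) holomorphic_on unit_disc"
    using one_minus_mult_nonzero[OF l] by (intro holomorphic_intros) auto
  then show "normalized_kernel l holomorphic_on unit_disc"
    by (rule holomorphic_transform) (simp add: normalized_kernel_eq[OF l] bergman_kernel_def)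
  have "integrable disc_measure (\<lambda>z. (cmod (?c * bergman_kernel l z))\<^sup>2)"
  proof (rule integrable_const_bound[of _ "(cmod ?c * (1 / (1 - cmod l)\<^sup>2))\<^sup>2"])
    show "AE z in disc_measure. norm ((cmod (?c * bergman_kernel l z))\<^sup>2) \<le> (cmod ?c * (1 / (1 - cmod l)\<^sup>2))\<^sup>2"
    proof (rule AE_I2)
      fix z assume "z \<in> space disc_measure"
      then have "cmod (?c * bergman_kernel l z) \<le> cmod ?c * (1 / (1 - cmod l)\<^sup>2)"
        unfolding norm_mult by (intro mult_left_mono norm_bergman_kernel_le[OF l]) auto
      from power_mono[OF this, of 2]
      show "norm ((cmod (?c * bergman_kernel l z))\<^sup>2) \<le> (cmod ?c * (1 / (1 - cmod l)\<^sup>2))\<^sup>2"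
        by simp
    qed
  qed (use borel_measurable_bergman_kernel in measurable)
  also have "?this \<longleftrightarrow> integrable disc_measure (\<lambda>z. (cmod (normalized_kernel l z))\<^sup>2)"
    by (rule Bochner_Integration.integrable_cong) (auto simp: normalized_kernel_eq[OF l])
  finally show "integrable disc_measure (\<lambda>z. (cmod (normalized_kernel l z))\<^sup>2)" .
qed

lemma bergman_inner_monomial_normalized_kernel:
  assumes l: "cmod l < 1"
  shows "bergman_inner (disc_monomial n) (normalized_kernel l) = of_real (1 - (cmod l)\<^sup>2) * l ^ n"
proof -
  have "bergman_inner (disc_monomial n) (normalized_kernel l) =
      bergman_inner (disc_monomial n) (\<lambda>z. of_real (1 - (cmod l)\<^sup>2) * bergman_kernel l z)"
    by (rule bergman_inner_cong) (simp_all add: normalized_kernel_eq[OF l])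
  then show ?thesis
    by (simp add: bergman_inner_scale_right bergman_inner_monomial_kernel[OF l])
qed

section \<open>Maximum of the radial profile\<close>

text \<open>
  The weighted inequality of arithmetic and geometric means, scaled to have equality at the
  maximum \<open>t = n / (n + 2)\<close>, where \<open>x = y = 1\<close>. It follows from \<open>x \<le> exp (x - 1)\<close>, because
  the weighted exponents add up to zero.
\<close>
lemma power_times_square_le_max:
  fixes t :: real
  assumes "1 \<le> n" "0 \<le> t" "t \<le> 1"
  shows "t ^ n * (1 - t)\<^sup>2 \<le> 4 * real n ^ n / real (n + 2) ^ (n + 2)"
proof -
  define N where "N = real (n + 2)"
  define x where "x = t * N / real n"
  define y where "y = (1 - t) * N / 2"
  have N: "0 < N"
    by (simp add: N_def)
  have xy: "0 \<le> x" "0 \<le> y"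
    using assms N by (auto simp: x_def y_def)
  have weights: "real n * (x - 1) + 2 * (y - 1) = 0"
    using assms by (simp add: x_def y_def N_def field_simps)
  have "x ^ n * y\<^sup>2 \<le> exp (x - 1) ^ n * exp (y - 1) ^ 2"
    using xy exp_ge_add_one_self[of "x - 1"] exp_ge_add_one_self[of "y - 1"]
    by (intro mult_mono power_mono) auto
  also have "\<dots> = exp (real n * (x - 1) + 2 * (y - 1))"
    by (simp add: exp_add exp_of_nat_mult flip: exp_of_nat_mult[of 2, simplified])
  finally have le_1: "x ^ n * y\<^sup>2 \<le> 1"
    by (simp only: weights exp_zero)
  have "t ^ n * (1 - t)\<^sup>2 = x ^ n * y\<^sup>2 * (4 * real n ^ n / (N ^ n * N\<^sup>2))"
    using assms N by (simp add: x_def y_def power_divide power_mult_distrib)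
  also have "\<dots> \<le> 1 * (4 * real n ^ n / (N ^ n * N\<^sup>2))"
    using N by (intro mult_right_mono le_1) simp
  finally show ?thesis
    by (simp add: N_def flip: power_add)
qed

lemma image_power_times_square:
  assumes n: "1 \<le> n"
  shows "(\<lambda>t::real. t ^ n * (1 - t)\<^sup>2) ` {0..<1} = {0..4 * real n ^ n / real (n + 2) ^ (n + 2)}"
    (is "?h ` _ = {0..?M}")
proof (intro equalityI subsetI)
  fix y assume "y \<in> ?h ` {0..<1}"
  then show "y \<in> {0..?M}"
    using power_times_square_le_max[OF n] by auto
next
  fix y assume y: "y \<in> {0..?M}"
  \<comment> \<open>The maximum is attained at \<open>s < 1\<close>, so the half-open interval suffices.\<close>
  define s where "s = real n / real (n + 2)"
  have s: "0 \<le> s" "s < 1"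
    by (auto simp: s_def)
  have one_minus_s: "1 - s = 2 / real (n + 2)"
    by (simp add: s_def field_simps)
  have "?h s = 4 * real n ^ n / (real (n + 2) ^ n * (real (n + 2))\<^sup>2)"
    unfolding one_minus_s by (simp add: s_def power_divide)
  then have "?h s = ?M"
    by (simp only: power_add)
  then have "y \<le> ?h s"
    using y by simp
  moreover have "?h 0 \<le> y"
    using y n by (simp add: power_0_left)
  moreover have "continuous_on {0..s} ?h"
    by (intro continuous_intros)
  ultimately obtain t where "0 \<le> t" "t \<le> s" "?h t = y"
    using IVT'[of ?h 0 y s] s by blast
  then show "y \<in> ?h ` {0..<1}"
    using s by force
qed

section \<open>The Berezin range\<close>

text \<open>
  This holds for every rank one operator \<open>g \<otimes> g\<close>: one factor comes from the coefficient of
  the operator, its conjugate from the outer inner product.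
\<close>
lemma berezin_transform_rank_one:
  assumes A: "\<And>f. f \<in> bergman_space \<Longrightarrow> A f = (\<lambda>z\<in>unit_disc. bergman_inner f g * g z)"
    and l: "cmod l < 1"
  shows "berezin_transform A l = of_real ((cmod (bergman_inner g (normalized_kernel l)))\<^sup>2)"
proof -
  let ?c = "bergman_inner (normalized_kernel l) g"
  have "berezin_transform A l = bergman_inner (\<lambda>z. ?c * g z) (normalized_kernel l)"
    unfolding berezin_transform_def A[OF normalized_kernel_in_bergman_space[OF l]]
    by (rule bergman_inner_cong) simp_all
  also have "\<dots> = ?c * bergman_inner g (normalized_kernel l)"
    by (rule bergman_inner_scale_left)
  also have "\<dots> = cnj (bergman_inner g (normalized_kernel l)) * bergman_inner g (normalized_kernel l)"
    by (subst bergman_inner_cnj) simp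
  finally show ?thesis
    unfolding complex_norm_square by (simp only: mult.commute)
qed

lemma norm_square_image_unit_disc: "(\<lambda>l. (cmod l)\<^sup>2) ` unit_disc = {0..<1}"
proof (intro equalityI subsetI)
  fix t :: real assume "t \<in> {0..<1}"
  then have "complex_of_real (sqrt t) \<in> unit_disc" "(cmod (complex_of_real (sqrt t)))\<^sup>2 = t"
    by auto
  then show "t \<in> (\<lambda>l. (cmod l)\<^sup>2) ` unit_disc"
    by (metis image_eqI)
qed (auto simp: abs_square_less_1)

theorem proposition3p2:
  fixes n :: nat
    and A :: "(complex \<Rightarrow> complex) \<Rightarrow> complex \<Rightarrow> complex"
  assumes "n \<ge> 1"
    and "\<And>f. f \<in> bergman_space \<Longrightarrow>
           A f = (\<lambda>z\<in>unit_disc. bergman_inner f (disc_monomial n) * disc_monomial n z)"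
  shows "berezin_range A = complex_of_real ` {0 .. 4 * real n ^ n / real (n + 2) ^ (n + 2)}
         \<and> convex (berezin_range A)"
proof
  let ?h = "\<lambda>t::real. t ^ n * (1 - t)\<^sup>2"
  have "berezin_transform A l = of_real (?h ((cmod l)\<^sup>2))" if "l \<in> unit_disc" for l
  proof -
    have l: "cmod l < 1"
      using that by simp
    have "berezin_transform A l = of_real ((cmod (of_real (1 - (cmod l)\<^sup>2) * l ^ n))\<^sup>2)"
      using berezin_transform_rank_one[OF assms(2) l]
      by (simp only: bergman_inner_monomial_normalized_kernel[OF l])
    also have "(cmod (of_real (1 - (cmod l)\<^sup>2) * l ^ n))\<^sup>2 = ?h ((cmod l)\<^sup>2)"
      unfolding norm_mult norm_of_real norm_power power_mult_distrib power2_abs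
      by (simp flip: power_mult add: mult.commute)
    finally show ?thesis .
  qed
  then have "berezin_range A = complex_of_real ` ?h ` (\<lambda>l. (cmod l)\<^sup>2) ` unit_disc"
    unfolding berezin_range_def image_image by (intro image_cong) simp_all
  then show range: "berezin_range A = complex_of_real ` {0 .. 4 * real n ^ n / real (n + 2) ^ (n + 2)}"
    by (simp only: norm_square_image_unit_disc image_power_times_square[OF assms(1)])
  show "convex (berezin_range A)"
    unfolding range by (intro convex_linear_image bounded_linear.linear bounded_linear_of_real) simp
qed

end
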